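(* Let $r \geq 2$ be an integer. For every $r$-graph $G$, \[\tau(G) \geq \sum_{H \in \mathcal{C}(G)} \left\lceil \frac{|V(H)|-1}{\Delta(H)(r-1)} \right\rceil,\] and equality holds if for each $H \in \mathcal{C}(G)$, $H$ is a copy of $U_{|V(H)|,r,\Delta(H)}$.
   Context: All sets are finite unless evidently infinite; $\mathbb{N}=\{1,2,\dots\}$; for integers $1\le m \leq n$, $[m,n] = \{i \in \mathbb{N} : m \leq i \leq n\}$ and $[n]=[1,n]$; $[0]=\emptyset$. For a set $X$, $\binom{X}{r}$ is the set of all $r$-element subsets of $X$. An $r$-graph $G$ is a pair $(V(G),E(G))$ where $V(G)$ is a set (of vertices) and $E(G) \subseteq \binom{V(G)}{r}$ (the edges). A set $T \subseteq V(G)$ is a transversal of $G$ if $e \cap T \neq \emptyset$ for each $e \in E(G)$; $\tau(G)$ is the size of a smallest transversal of $G$. The degree $d_G(v)$ of a vertex $v$ is the number of edges containing $v$; $\Delta(G) = \max\{d_G(v) : v \in V(G)\}$. A $vw$-path of $G$ is a sequence $e_1,\dots,e_p$ of edges ($p \geq 1$) with $v \in e_1$, $w \in e_p$, and $e_i \cap e_{i+1} \neq \emptyset$ for each $i \in [p-1]$. $G$ is connected if it has a $vw$-path for every two distinct vertices $v,w$. An $r$-graph $H$ is a subgraph of $G$ if $V(H)\subseteq V(G)$ and $E(H)\subseteq E(G)$. A component of $G$ is a maximal connected subgraph of $G$ (a connected subgraph that is not a subgraph of another connected subgraph). A singleton is an $r$-graph consisting of only one vertex; $\mathcal{C}(G)$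 denotes the set of non-singleton components of $G$, i.e. those with at least two vertices. "Copy" means isomorphic copy. For $r \geq 2$ and $k \geq 1$, $f(r,k)$ is the smallest integer $n$ such that there exists an $r$-graph $G$ with $\Delta(G)=k$ and $|V(G)|=n$. The $r$-graphs $U_{n,r,k}$: $U_{r,r,1} = ([r],\{[r]\})$ (a connected $r$-graph with at least two vertices and maximum degree $1$ has exactly $r$ vertices). For $r \geq 2$, $k \geq 2$, $n \geq f(r,k)$, define $U_{n,r,k}$ as follows. Let $p = \left\lceil \frac{n-1}{k(r-1)} \right\rceil$, so $p \geq 1$ and $n-1 = (p-1)k(r-1)+q$ for some integer $q$ with $1 \leq q \leq k(r-1)$. Let $n' = n-p$, so $n' = (p-1)(k(r-1)-1)+q$. For each $(i,j,h) \in \mathbb{N} \times [k] \times [r-1]$, let \[x_{i,j,h} = (i-1)(k(r-1)-1) + (j-1)(r-1) + h.\] For each $i \in [p]$, let $y_i = n'+i$. For each $(i,j) \in [p]\times[k]$, let $X_{i,j} = \{x_{i,j,h} : h \in [r-1]\}$ and $Y_{i,j} = X_{i,j} \cup \{y_i\}$. Write $q = s(r-1)+t$ with $s \in \{0\}\cup[k]$ and $t \in \{0\} \cup [r-2]$ (where $s<k$ if $t>0$, and $s>0$ if $t=0$). Let $X'_{p,s+1} = [n'-r+2, n']$ and $Y'_{p,s+1} = X'_{p,s+1} \cup \{y_p\}$. Let \[M_{n,r,k} = \{Y_{i,j} : (i,j) \in ([p-1]\times[k]) \cup (\{p\}\times[s])\} \cup \{Y'_{p,s+1}\}.\] If $n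 > k(r-1)+1$, then $U_{n,r,k} = ([n], M_{n,r,k})$. If $n \leq k(r-1)+1$ (so $p=1$ and $y_1=n$), choose a set $S_{n,r,k}$ with $M_{n,r,k} \subseteq S_{n,r,k} \subseteq \{A \in \binom{[n]}{r} : n \in A\}$ and $|S_{n,r,k}| = k$ (possible because $n \geq f(r,k)$; any fixed choice), and let $U_{n,r,k} = ([n], S_{n,r,k})$. *)

theory Defs
  imports Complex_Main "HOL-Library.Ramsey"
begin

type_synonym 'a hypergraph = "'a set \<times> 'a set set"

abbreviation verts :: "'a hypergraph \<Rightarrow> 'a set" where
  "verts \<equiv> fst"

abbreviation edges :: "'a hypergraph \<Rightarrow> 'a set set" where
  "edges \<equiv> snd"

definition r_graph :: "nat \<Rightarrow> 'a hypergraph \<Rightarrow> bool" where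
  "r_graph r G \<longleftrightarrow> finite (verts G) \<and> edges G \<subseteq> nsets (verts G) r"

definition transversal :: "'a hypergraph \<Rightarrow> 'a set \<Rightarrow> bool" where
  "transversal G T \<longleftrightarrow> T \<subseteq> verts G \<and> (\<forall>e\<in>edges G. e \<inter> T \<noteq> {})"

definition transversal_number :: "'a hypergraph \<Rightarrow> nat" where
  "transversal_number G = (LEAST m. \<exists>T. transversal G T \<and> card T = m)"

definition degree :: "'a hypergraph \<Rightarrow> 'a \<Rightarrow> nat" where
  "degree G v = card {e \<in> edges G. v \<in> e}"

text \<open>The \<open>insert 0\<close> only matters for the hypergraph without vertices, whose maximum degree
  is thereby \<open>0\<close> instead of the unspecified value \<open>Max {}\<close>.\<close>

definition max_degree :: "'a hypergraph \<Rightarrow> nat" where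
  "max_degree G = Max (insert 0 (degree G ` verts G))"

definition edge_path :: "'a hypergraph \<Rightarrow> 'a \<Rightarrow> 'a \<Rightarrow> 'a set list \<Rightarrow> bool" where
  "edge_path G v w es \<longleftrightarrow>
     es \<noteq> [] \<and> set es \<subseteq> edges G \<and> v \<in> hd es \<and> w \<in> last es \<and>
     (\<forall>i. Suc i < length es \<longrightarrow> es ! i \<inter> es ! Suc i \<noteq> {})"

definition connected_hypergraph :: "'a hypergraph \<Rightarrow> bool" where
  "connected_hypergraph G \<longleftrightarrow>
     (\<forall>v\<in>verts G. \<forall>w\<in>verts G. v \<noteq> w \<longrightarrow> (\<exists>es. edge_path G v w es))"

definition subgraph :: "nat \<Rightarrow> 'a hypergraph \<Rightarrow> 'a hypergraph \<Rightarrow> bool" where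
  "subgraph r H G \<longleftrightarrow> r_graph r H \<and> verts H \<subseteq> verts G \<and> edges H \<subseteq> edges G"

definition component :: "nat \<Rightarrow> 'a hypergraph \<Rightarrow> 'a hypergraph \<Rightarrow> bool" where
  "component r G H \<longleftrightarrow>
     subgraph r H G \<and> connected_hypergraph H \<and>
     \<not> (\<exists>K. subgraph r K G \<and> connected_hypergraph K \<and> K \<noteq> H \<and> subgraph r H K)"

definition nonsingleton_components :: "nat \<Rightarrow> 'a hypergraph \<Rightarrow> 'a hypergraph set" where
  "nonsingleton_components r G = {H. component r G H \<and> card (verts H) \<ge> 2}"

definition is_copy :: "'a hypergraph \<Rightarrow> 'b hypergraph \<Rightarrow> bool" where
  "is_copy H K \<longleftrightarrow>
     (\<exists>\<phi>. bij_betw \<phi> (verts H) (verts K) \<and> edges K = (\<lambda>e. \<phi> ` e) ` edges H)"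

text \<open>Vertices in \<open>nat\<close> suffice, as every finite hypergraph has a copy there.\<close>

definition min_order :: "nat \<Rightarrow> nat \<Rightarrow> nat" where
  "min_order r k = (LEAST n. \<exists>G :: nat hypergraph.
     r_graph r G \<and> max_degree G = k \<and> card (verts G) = n)"

definition U_p :: "nat \<Rightarrow> nat \<Rightarrow> nat \<Rightarrow> nat" where
  "U_p n r k = nat \<lceil>(real n - 1) / (real k * (real r - 1))\<rceil>"

definition U_x :: "nat \<Rightarrow> nat \<Rightarrow> nat \<Rightarrow> nat \<Rightarrow> nat \<Rightarrow> nat" where
  "U_x r k i j h = (i - 1) * (k * (r - 1) - 1) + (j - 1) * (r - 1) + h"

text \<open>\<open>q\<close> is the number with \<open>n - 1 = (p - 1) k (r - 1) + q\<close>; since \<open>1 \<le> q \<le> k (r - 1)\<close>, the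
  representation \<open>q = s (r - 1) + t\<close> is division with remainder.  The lower end of the interval
  \<open>[n' - r + 2, n']\<close> is written \<open>n' + 2 - r\<close> because \<open>n' - r\<close> would be truncated
  for \<open>n' = r - 1\<close>.\<close>

definition U_M :: "nat \<Rightarrow> nat \<Rightarrow> nat \<Rightarrow> nat set set" where
  "U_M n r k =
    (let p = U_p n r k;
         q = (n - 1) - (p - 1) * k * (r - 1);
         n' = n - p;
         s = q div (r - 1);
         y = (\<lambda>i. n' + i);
         X = (\<lambda>i j. {U_x r k i j h | h. h \<in> {1..r - 1}});
         Y = (\<lambda>i j. X i j \<union> {y i});
         Y' = {n' + 2 - r..n'} \<union> {y p}
     in {Y i j | i j. (i, j) \<in> ({1..p - 1} \<times> {1..k}) \<union> ({p} \<times> {1..s})} \<union> {Y'})"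

text \<open>In the range \<open>n \<le> k (r - 1) + 1\<close> the edge set of the extremal hypergraph is an arbitrary
  but fixed choice; \<open>S\<close> is such a choice for all parameters.  The bound \<open>n \<ge> min_order r k\<close>
  ensures that such \<open>S\<close> exist: it makes \<open>{1..n}\<close> have at least \<open>k\<close> subsets of size \<open>r\<close> containing \<open>n\<close>.\<close>

definition valid_choice :: "(nat \<Rightarrow> nat \<Rightarrow> nat \<Rightarrow> nat set set) \<Rightarrow> bool" where
  "valid_choice S \<longleftrightarrow>
     (\<forall>n r k. r \<ge> 2 \<and> k \<ge> 2 \<and> n \<ge> min_order r k \<and> n \<le> k * (r - 1) + 1 \<longrightarrow>
        U_M n r k \<subseteq> S n r k \<and> S n r k \<subseteq> {A \<in> nsets {1..n} r. n \<in> A} \<and> card (S n r k) = k)"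

text \<open>Meaningful for \<open>k = 1\<close>, \<open>n = r\<close> and for \<open>k \<ge> 2\<close>, \<open>n \<ge> min_order r k\<close>; every connected
  \<open>r\<close>-graph with \<open>n \<ge> 2\<close> vertices and maximum degree \<open>k\<close> falls into one of these cases.\<close>

definition U_graph ::
  "(nat \<Rightarrow> nat \<Rightarrow> nat \<Rightarrow> nat set set) \<Rightarrow> nat \<Rightarrow> nat \<Rightarrow> nat \<Rightarrow> nat hypergraph" where
  "U_graph S n r k =
    (if k = 1 then ({1..r}, {{1..r}})
     else if n > k * (r - 1) + 1 then ({1..n}, U_M n r k)
     else ({1..n}, S n r k))"

end

theory Submission imports Defs
begin

text \<open>
  For the lower bound, consider a connected \<open>r\<close>-graph \<open>H\<close> with \<open>n\<close> vertices and \<open>m\<close> edges.  Growing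
  a vertex set from a single vertex by adding one edge at a time, each edge meeting what has been
  reached so far, adds at most \<open>r - 1\<close> vertices per edge; hence \<open>n - 1 \<le> m (r - 1)\<close>
  (\<open>connected_order_le_edges\<close>).  On the other hand, every edge contains one of the vertices of a
  transversal \<open>T\<close>, and each vertex covers at most \<open>\<Delta>(H)\<close> edges; hence \<open>m \<le> \<Delta>(H) |T|\<close>
  (\<open>card_edges_le_transversal\<close>).  Together, \<open>|T| \<ge> (n - 1) / (\<Delta>(H) (r - 1))\<close>, and rounding up is
  possible because \<open>|T|\<close> is an integer.

  The passage to arbitrary \<open>G\<close> is additivity of \<open>\<tau>\<close> over components
  (\<open>transversal_number_sum_components\<close>): distinct components have no common vertex, and every edge
  lies in a component, which has at least two vertices as \<open>r \<ge> 2\<close>.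

  For equality, with \<open>n = |V(H)|\<close> and \<open>k = \<Delta>(H)\<close>, it suffices that
  \<open>\<tau>(U_graph S n r k) \<le> U_p n r k\<close>: every edge contains one of the
  hubs \<open>y\<^sub>1, \<dots>, y\<^sub>p\<close>, and when \<open>n \<le> k (r - 1) + 1\<close> the only hub is \<open>n\<close>, which every edge of a valid
  choice contains.  In that range, a valid choice is only constrained if
  \<open>n \<ge> min_order r k\<close>; this is ensured by \<open>U_graph S n r k\<close> being a copy of an \<open>r\<close>-graph of maximum
  degree \<open>k\<close> with \<open>n\<close> vertices.
\<close>

section \<open>Transversals and degrees\<close>

lemma transversal_verts:
  assumes "r \<ge> 1" "r_graph r G"
  shows "transversal G (verts G)"
  unfolding transversal_def
proof (intro conjI ballI)
  fix e assume "e \<in> edges G"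
  then have "e \<subseteq> verts G" "card e = r"
    using assms(2) by (auto simp: r_graph_def nsets_def)
  then show "e \<inter> verts G \<noteq> {}"
    using assms(1) by (auto simp: Int_absorb2)
qed simp

lemma transversal_number_le: "transversal G T \<Longrightarrow> transversal_number G \<le> card T"
  unfolding transversal_number_def by (rule Least_le) blast

lemma transversal_number_attained:
  assumes "r \<ge> 1" "r_graph r G"
  obtains T where "transversal G T" "card T = transversal_number G"
proof -
  have "\<exists>m T. transversal G T \<and> card T = m"
    using transversal_verts[OF assms] by blast
  then have "\<exists>T. transversal G T \<and> card T = transversal_number G"
    unfolding transversal_number_def by (rule LeastI_ex)
  with that show thesis by blast
qed

lemma finite_transversal: "r_graph r G \<Longrightarrow> transversal G T \<Longrightarrow> finite T"
  by (auto simp: r_graph_def transversal_def intro: finite_subset)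

lemma finite_edges: "r_graph r G \<Longrightarrow> finite (edges G)"
  unfolding r_graph_def by (meson finite_imp_finite_nsets finite_subset)

lemma degree_le_max_degree:
  "r_graph r G \<Longrightarrow> v \<in> verts G \<Longrightarrow> degree G v \<le> max_degree G"
  unfolding max_degree_def r_graph_def by (intro Max_ge) auto

lemma card_edges_le_transversal:
  assumes "r_graph r G" "transversal G T"
  shows "card (edges G) \<le> max_degree G * card T"
proof -
  have T: "finite T" "T \<subseteq> verts G"
    using finite_transversal[OF assms] assms(2) by (auto simp: transversal_def)
  have "edges G \<subseteq> (\<Union>v\<in>T. {e \<in> edges G. v \<in> e})"
    using assms(2) by (fastforce simp: transversal_def)
  then have "card (edges G) \<le> card (\<Union>v\<in>T. {e \<in> edges G. v \<in> e})"
    using T(1) finite_edges[OF assms(1)] by (intro card_mono) auto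
  also have "\<dots> \<le> (\<Sum>v\<in>T. degree G v)"
    unfolding degree_def using T(1) by (rule card_UN_le)
  also have "\<dots> \<le> (\<Sum>v\<in>T. max_degree G)"
    using T(2) degree_le_max_degree[OF assms(1)] by (intro sum_mono) blast
  finally show ?thesis by (simp add: mult.commute)
qed

section \<open>Connected hypergraphs\<close>

text \<open>A path that leaves a vertex set \<open>W\<close> crosses its boundary: if every edge meeting \<open>W\<close> were
  contained in \<open>W\<close>, then so would be every edge of the path, one after the other.\<close>

lemma edge_path_crosses:
  assumes path: "edge_path G v w es" and "v \<in> W" "w \<notin> W"
  obtains e where "e \<in> edges G" "e \<inter> W \<noteq> {}" "\<not> e \<subseteq> W"
proof (rule ccontr)
  assume "\<not> thesis"
  with that have closed: "e \<subseteq> W" if "e \<in> edges G" "e \<inter> W \<noteq> {}" for e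
    using that by blast
  have in_edges: "es ! i \<in> edges G" if "i < length es" for i
    using path that nth_mem unfolding edge_path_def by blast
  have "es ! i \<subseteq> W" if "i < length es" for i
    using that
  proof (induction i)
    case 0
    have "v \<in> es ! 0"
      using path by (auto simp: edge_path_def hd_conv_nth)
    with 0 show ?case
      using closed in_edges \<open>v \<in> W\<close> by blast
  next
    case (Suc i)
    then have "es ! i \<inter> es ! Suc i \<noteq> {}" "es ! i \<subseteq> W"
      using path by (auto simp: edge_path_def)
    with Suc.prems show ?case
      using closed[OF in_edges] by blast
  qed
  then have "last es \<subseteq> W"
    using path by (auto simp: edge_path_def last_conv_nth)
  then show False
    using path \<open>w \<notin> W\<close> by (auto simp: edge_path_def)
qed

lemma edge_path_append:
  assumes "edge_path G v u es" "edge_path G u w fs"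
  shows "edge_path G v w (es @ fs)"
proof -
  have "(es @ fs) ! i \<inter> (es @ fs) ! Suc i \<noteq> {}" if i: "Suc i < length (es @ fs)" for i
  proof -
    consider "Suc i < length es" | "Suc i = length es" | "i \<ge> length es"
      by linarith
    then show ?thesis
    proof cases
      case 1
      then show ?thesis
        using assms by (simp add: edge_path_def nth_append)
    next
      case 2
      then have "(es @ fs) ! i = last es" "(es @ fs) ! Suc i = hd fs"
        using assms by (auto simp: edge_path_def nth_append last_conv_nth hd_conv_nth
            dest: sym)
      then show ?thesis
        using assms by (auto simp: edge_path_def)
    next
      case 3
      then show ?thesis
        using assms i by (simp add: edge_path_def nth_append Suc_diff_le)
    qed
  qed
  then show ?thesis
    using assms by (auto simp: edge_path_def)
qed

lemma edge_path_mono: "edge_path H v w es \<Longrightarrow> edges H \<subseteq> edges G \<Longrightarrow> edge_path G v w es"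
  by (auto simp: edge_path_def)

text \<open>A maximal set \<open>F\<close> of edges that, together with a fixed vertex \<open>v\<close>, spans a set \<open>W\<close> of at most
  \<open>|F| (r - 1) + 1\<close> vertices spans everything: otherwise some edge \<open>e\<close> crosses the boundary of \<open>W\<close>, and
  as \<open>e\<close> shares a vertex with \<open>W\<close>, adding it to \<open>F\<close> costs at most \<open>r - 1\<close> new vertices.\<close>

lemma connected_order_le_edges:
  assumes G: "r_graph r G" and conn: "connected_hypergraph G"
  shows "card (verts G) \<le> card (edges G) * (r - 1) + 1"
proof (cases "verts G = {}")
  case False
  then obtain v where v: "v \<in> verts G" by blast
  define W where "W F = insert v (\<Union>F)" for F
  define P where "P F \<longleftrightarrow> F \<subseteq> edges G \<and> card (W F) \<le> card F * (r - 1) + 1" for F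
  have finV: "finite (verts G)" and finE: "finite (edges G)"
    using G finite_edges[OF G] by (simp_all add: r_graph_def)
  have edge: "e \<subseteq> verts G" "card e = r" if "e \<in> edges G" for e
    using G that by (auto simp: r_graph_def nsets_def)
  have "P {}" by (simp add: P_def W_def)
  moreover have "\<forall>F. P F \<longrightarrow> card F < Suc (card (edges G))"
    using finE by (auto simp: P_def less_Suc_eq_le intro: card_mono)
  ultimately obtain F where F: "P F" and max: "\<And>F'. P F' \<Longrightarrow> card F' \<le> card F"
    using ex_has_greatest_nat[of P "{}" card "Suc (card (edges G))"] by metis
  have WV: "W F \<subseteq> verts G"
    using F v edge(1) by (auto simp: P_def W_def)
  have "W F = verts G"
  proof (rule ccontr)
    assume "W F \<noteq> verts G"
    with WV obtain w where w: "w \<in> verts G" "w \<notin> W F" by blast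
    have vW: "v \<in> W F" by (simp add: W_def)
    with w have "v \<noteq> w" by blast
    with conn v w obtain es where "edge_path G v w es"
      by (auto simp: connected_hypergraph_def)
    then obtain e where e: "e \<in> edges G" "e \<inter> W F \<noteq> {}" "\<not> e \<subseteq> W F"
      using vW w(2) by (rule edge_path_crosses)
    have "e \<notin> F" using e(3) by (auto simp: W_def)
    have finF: "finite F" using F finE by (auto simp: P_def intro: finite_subset)
    have fine: "finite e" using edge(1)[OF e(1)] finV finite_subset by blast
    have "card (e - W F) < card e"
      using e(2) fine by (intro psubset_card_mono) auto
    then have new: "card (e - W F) \<le> r - 1"
      using edge(2)[OF e(1)] by simp
    have "W (insert e F) = W F \<union> (e - W F)"
      by (auto simp: W_def)
    then have "card (W (insert e F)) \<le> card (W F) + card (e - W F)"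
      by (metis card_Un_le)
    also have "\<dots> \<le> card (insert e F) * (r - 1) + 1"
      using F new \<open>e \<notin> F\<close> finF by (simp add: P_def)
    finally have "P (insert e F)"
      using F e(1) by (simp add: P_def)
    from max[OF this] show False
      using \<open>e \<notin> F\<close> finF by simp
  qed
  then have "card (verts G) \<le> card F * (r - 1) + 1"
    using F by (simp add: P_def)
  also have "card F \<le> card (edges G)"
    using F finE by (auto simp: P_def intro: card_mono)
  finally show ?thesis by simp
qed simp

lemma max_degree_pos:
  assumes "r \<ge> 1" "r_graph r G" "connected_hypergraph G" "card (verts G) \<ge> 2"
  shows "max_degree G > 0"
proof (rule ccontr)
  assume "\<not> max_degree G > 0"
  then have "card (edges G) = 0"
    using card_edges_le_transversal[OF assms(2) transversal_verts[OF assms(1,2)]] by simp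
  then show False
    using connected_order_le_edges[OF assms(2,3)] assms(4) by simp
qed

lemma connected_transversal_number_ge:
  assumes "r \<ge> 2" "r_graph r G" "connected_hypergraph G"
  shows "\<lceil>(real (card (verts G)) - 1) / (real (max_degree G) * (real r - 1))\<rceil>
           \<le> int (transversal_number G)"
proof -
  obtain T where T: "transversal G T" "card T = transversal_number G"
    using transversal_number_attained[of r G] assms by auto
  let ?d = "real (max_degree G) * (real r - 1)"
  have "card (verts G) \<le> card (edges G) * (r - 1) + 1"
    using connected_order_le_edges[OF assms(2,3)] .
  also have "\<dots> \<le> max_degree G * card T * (r - 1) + 1"
    by (intro add_right_mono mult_right_mono card_edges_le_transversal[OF assms(2) T(1)]) simp
  finally have "real (card (verts G)) \<le> real (max_degree G * card T * (r - 1) + 1)"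
    by (rule of_nat_mono)
  also have "\<dots> = real (card T) * ?d + 1"
    using assms(1) by (simp add: of_nat_diff)
  finally have bound: "real (card (verts G)) - 1 \<le> real (card T) * ?d"
    by simp
  have "(real (card (verts G)) - 1) / ?d \<le> real (card T)"
  proof (cases "max_degree G = 0")
    case False
    then have "?d > 0" using assms(1) by simp
    with bound show ?thesis by (simp add: pos_divide_le_eq)
  qed simp
  then show ?thesis
    using T(2) by (simp add: ceiling_le_iff)
qed

section \<open>Additivity over components\<close>

lemma connected_union:
  assumes "connected_hypergraph H" "connected_hypergraph K" "u \<in> verts H" "u \<in> verts K"
  shows "connected_hypergraph (verts H \<union> verts K, edges H \<union> edges K)" (is "connected_hypergraph ?U")
proof -
  have H: "\<exists>es. edge_path ?U v w es" if vw: "v \<in> verts H" "w \<in> verts H" "v \<noteq> w" for v w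
  proof -
    obtain es where "edge_path H v w es"
      using assms(1) vw unfolding connected_hypergraph_def by blast
    then have "edge_path ?U v w es"
      by (rule edge_path_mono) simp
    then show ?thesis ..
  qed
  have K: "\<exists>es. edge_path ?U v w es" if vw: "v \<in> verts K" "w \<in> verts K" "v \<noteq> w" for v w
  proof -
    obtain es where "edge_path K v w es"
      using assms(2) vw unfolding connected_hypergraph_def by blast
    then have "edge_path ?U v w es"
      by (rule edge_path_mono) simp
    then show ?thesis ..
  qed
  show ?thesis
    unfolding connected_hypergraph_def
  proof (intro ballI impI)
    fix v w assume vw: "v \<in> verts ?U" "w \<in> verts ?U" "v \<noteq> w"
    have vu: "\<exists>es. edge_path ?U v u es" if "v \<noteq> u"
      using H[of v u] K[of v u] vw(1) assms(3,4) that by auto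
    have uw: "\<exists>es. edge_path ?U u w es" if "w \<noteq> u"
      using H[of u w] K[of u w] vw(2) assms(3,4) that by auto
    consider "v = u" | "w = u" | "v \<noteq> u" "w \<noteq> u" by blast
    then show "\<exists>es. edge_path ?U v w es"
    proof cases
      case 3
      then obtain es fs where "edge_path ?U v u es" "edge_path ?U u w fs"
        using vu uw by blast
      then have "edge_path ?U v w (es @ fs)"
        by (rule edge_path_append)
      then show ?thesis ..
    qed (use vu uw vw(3) in auto)
  qed
qed

lemma subgraph_union:
  assumes "subgraph r H G" "subgraph r K G"
  shows "subgraph r (verts H \<union> verts K, edges H \<union> edges K) G"
  using assms unfolding subgraph_def r_graph_def nsets_def by auto

lemma components_disjoint:
  assumes H: "component r G H" and K: "component r G K" and "H \<noteq> K"
  shows "verts H \<inter> verts K = {}"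
proof (rule ccontr)
  assume "verts H \<inter> verts K \<noteq> {}"
  then obtain u where u: "u \<in> verts H" "u \<in> verts K" by blast
  define U where "U = (verts H \<union> verts K, edges H \<union> edges K)"
  have U: "subgraph r U G" "connected_hypergraph U"
    using subgraph_union[of r H G K] connected_union[of H K u] u H K
    by (auto simp: U_def component_def)
  have "subgraph r H U" "subgraph r K U"
    using H K by (auto simp: U_def component_def subgraph_def)
  with U H K have "U = H" "U = K"
    unfolding component_def by blast+
  with \<open>H \<noteq> K\<close> show False by simp
qed

text \<open>Among the connected subgraphs of \<open>G\<close> that contain \<open>H\<close>, one with the largest total number of
  vertices and edges is a component.\<close>

lemma connected_subgraph_in_component:
  assumes G: "r_graph r G" and "subgraph r H G" "connected_hypergraph H"
  obtains K where "component r G K" "subgraph r H K"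
proof -
  define P where "P K \<longleftrightarrow> subgraph r K G \<and> connected_hypergraph K \<and> subgraph r H K" for K
  define size where "size K = card (verts K) + card (edges K)" for K :: "'a hypergraph"
  have fin: "finite (verts G)" "finite (edges G)"
    using G finite_edges[OF G] by (simp_all add: r_graph_def)
  have "P H" using assms by (auto simp: P_def subgraph_def)
  moreover have "\<forall>K. P K \<longrightarrow> size K < Suc (size G)"
    using fin by (auto simp: P_def subgraph_def size_def less_Suc_eq_le intro!: add_mono card_mono)
  ultimately obtain K where K: "P K" and max: "\<And>L. P L \<Longrightarrow> size L \<le> size K"
    using ex_has_greatest_nat[of P H size "Suc (size G)"] by metis
  have "L = K" if L: "subgraph r L G" "connected_hypergraph L" "subgraph r K L" for L
  proof -
    have sub: "verts K \<subseteq> verts L" "edges K \<subseteq> edges L"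
      using L(3) by (auto simp: subgraph_def)
    have finL: "finite (verts L)" "finite (edges L)"
      using L(1) fin by (auto simp: subgraph_def intro: finite_subset)
    have "P L"
      using L K by (auto simp: P_def subgraph_def)
    from max[OF this] have "size L \<le> size K" .
    with card_mono[OF finL(1) sub(1)] card_mono[OF finL(2) sub(2)]
    have "card (verts K) = card (verts L)" "card (edges K) = card (edges L)"
      by (auto simp: size_def)
    then show ?thesis
      using card_subset_eq[OF finL(1) sub(1)] card_subset_eq[OF finL(2) sub(2)]
      by (simp add: prod_eq_iff)
  qed
  with K have "component r G K"
    unfolding component_def P_def by blast
  with K that show thesis by (auto simp: P_def)
qed

lemma edge_in_nonsingleton_component:
  assumes "r \<ge> 2" "r_graph r G" "e \<in> edges G"
  obtains H where "H \<in> nonsingleton_components r G" "e \<in> edges H"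
proof -
  have e: "e \<subseteq> verts G" "card e = r" "finite e"
    using assms by (auto simp: r_graph_def nsets_def)
  have "subgraph r (e, {e}) G"
    using e assms(3) by (auto simp: subgraph_def r_graph_def nsets_def)
  moreover have "edge_path (e, {e}) v w [e]" if "v \<in> e" "w \<in> e" for v w
    using that by (simp add: edge_path_def)
  then have "connected_hypergraph (e, {e})"
    unfolding connected_hypergraph_def by fastforce
  ultimately obtain H where H: "component r G H" "subgraph r (e, {e}) H"
    using connected_subgraph_in_component[OF assms(2)] by blast
  have "finite (verts H)" "e \<subseteq> verts H" "e \<in> edges H"
    using H by (auto simp: component_def subgraph_def r_graph_def)
  moreover from this have "card (verts H) \<ge> 2"
    using card_mono[of "verts H" e] e(2) assms(1) by linarith
  ultimately show thesis
    using that H(1) by (auto simp: nonsingleton_components_def)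
qed

lemma nonsingleton_component_connected:
  assumes "H \<in> nonsingleton_components r G"
  shows "r_graph r H" "connected_hypergraph H" "card (verts H) \<ge> 2"
    "verts H \<subseteq> verts G" "edges H \<subseteq> edges G"
  using assms by (auto simp: nonsingleton_components_def component_def subgraph_def)

lemma finite_nonsingleton_components:
  assumes "r_graph r G"
  shows "finite (nonsingleton_components r G)"
proof (rule finite_subset)
  show "nonsingleton_components r G \<subseteq> Pow (verts G) \<times> Pow (edges G)"
    using nonsingleton_component_connected(4,5) by (fastforce simp: mem_Times_iff)
  show "finite (Pow (verts G) \<times> Pow (edges G))"
    using assms finite_edges[OF assms] by (auto simp: r_graph_def)
qed

text \<open>A transversal of \<open>G\<close> restricts to transversals of the components, which are disjoint; conversely,
  transversals of the components combine to one of \<open>G\<close>, as no edge of \<open>G\<close> lies outside them.\<close>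

lemma transversal_number_sum_components:
  assumes r: "r \<ge> 2" and G: "r_graph r G"
  shows "transversal_number G = (\<Sum>H\<in>nonsingleton_components r G. transversal_number H)"
proof (rule antisym)
  let ?C = "nonsingleton_components r G"
  note comp = nonsingleton_component_connected[of _ r G]
  have fin: "finite ?C"
    using G by (rule finite_nonsingleton_components)
  have "\<exists>T. transversal H T \<and> card T = transversal_number H" if "H \<in> ?C" for H
    using transversal_number_attained[of r H] comp(1)[OF that] r by auto
  then obtain T where T: "\<And>H. H \<in> ?C \<Longrightarrow> transversal H (T H) \<and> card (T H) = transversal_number H"
    by metis
  have "transversal G (\<Union>H\<in>?C. T H)"
    unfolding transversal_def
  proof (intro conjI ballI)
    show "(\<Union>H\<in>?C. T H) \<subseteq> verts G"
      using T comp(4) by (fastforce simp: transversal_def)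
  next
    fix e assume "e \<in> edges G"
    then obtain H where "H \<in> ?C" "e \<in> edges H"
      using edge_in_nonsingleton_component[OF r G] by blast
    with T show "e \<inter> (\<Union>H\<in>?C. T H) \<noteq> {}"
      by (fastforce simp: transversal_def)
  qed
  then have "transversal_number G \<le> card (\<Union>H\<in>?C. T H)"
    by (rule transversal_number_le)
  also have "\<dots> \<le> (\<Sum>H\<in>?C. card (T H))"
    using fin by (rule card_UN_le)
  finally show "transversal_number G \<le> (\<Sum>H\<in>?C. transversal_number H)"
    using T by simp

  obtain R where R: "transversal G R" "card R = transversal_number G"
    using transversal_number_attained[of r G] r G by auto
  have finR: "finite R" using finite_transversal[OF G R(1)] .
  have "transversal H (R \<inter> verts H)" if "H \<in> ?C" for H
  proof -
    have "e \<inter> (R \<inter> verts H) \<noteq> {}" if e: "e \<in> edges H" for e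
    proof -
      have "e \<subseteq> verts H" "e \<in> edges G"
        using e comp(1,5)[OF \<open>H \<in> ?C\<close>] by (auto simp: r_graph_def nsets_def)
      moreover from this have "e \<inter> R \<noteq> {}"
        using R(1) by (auto simp: transversal_def)
      ultimately show ?thesis by blast
    qed
    then show ?thesis by (simp add: transversal_def)
  qed
  then have "(\<Sum>H\<in>?C. transversal_number H) \<le> (\<Sum>H\<in>?C. card (R \<inter> verts H))"
    by (intro sum_mono transversal_number_le)
  also have "\<dots> = card (\<Union>H\<in>?C. R \<inter> verts H)"
  proof (rule card_UN_disjoint[symmetric])
    show "\<forall>H\<in>?C. \<forall>K\<in>?C. H \<noteq> K \<longrightarrow> (R \<inter> verts H) \<inter> (R \<inter> verts K) = {}"
      using components_disjoint[of r G] by (fastforce simp: nonsingleton_components_def)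
  qed (use fin finR in auto)
  also have "\<dots> \<le> card R"
    using finR by (intro card_mono) auto
  finally show "(\<Sum>H\<in>?C. transversal_number H) \<le> transversal_number G"
    using R(2) by simp
qed

section \<open>Copies\<close>

lemma is_copy_card_verts: "is_copy H K \<Longrightarrow> card (verts H) = card (verts K)"
  by (auto simp: is_copy_def bij_betw_same_card)

lemma is_copy_r_graph:
  assumes H: "r_graph r H" and "is_copy H K"
  shows "r_graph r K"
proof -
  obtain f where f: "bij_betw f (verts H) (verts K)" "edges K = (\<lambda>e. f ` e) ` edges H"
    using assms(2) by (auto simp: is_copy_def)
  have "f ` e \<in> nsets (verts K) r" if "e \<in> edges H" for e
  proof -
    have e: "e \<subseteq> verts H" "finite e" "card e = r"
      using that H by (auto simp: r_graph_def nsets_def)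
    moreover have "inj_on f e"
      using f(1) e(1) by (auto simp: bij_betw_def intro: inj_on_subset)
    ultimately show ?thesis
      using f(1) by (auto simp: nsets_def card_image bij_betw_def)
  qed
  then show ?thesis
    using H f bij_betw_finite[OF f(1)] by (auto simp: r_graph_def)
qed

lemma is_copy_max_degree:
  assumes H: "r_graph r H" and "is_copy H K"
  shows "max_degree H = max_degree K"
proof -
  obtain f where f: "bij_betw f (verts H) (verts K)" "edges K = (\<lambda>e. f ` e) ` edges H"
    using assms(2) by (auto simp: is_copy_def)
  have inj: "inj_on f (verts H)" and img: "f ` verts H = verts K"
    using f(1) by (auto simp: bij_betw_def)
  have sub: "e \<subseteq> verts H" if "e \<in> edges H" for e
    using that H by (auto simp: r_graph_def nsets_def)
  have inj_edges: "inj_on (\<lambda>e. f ` e) (edges H)"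
  proof (rule inj_onI)
    fix e e' assume "e \<in> edges H" "e' \<in> edges H" "f ` e = f ` e'"
    then show "e = e'"
      using inj_on_image_eq_iff[OF inj sub sub] by blast
  qed
  have "degree K (f v) = degree H v" if v: "v \<in> verts H" for v
  proof -
    have "{e \<in> edges K. f v \<in> e} = (\<lambda>e. f ` e) ` {e \<in> edges H. v \<in> e}"
      unfolding f(2) using inj_on_image_mem_iff[OF inj v sub] by blast
    then show ?thesis
      unfolding degree_def using inj_edges
      by (simp add: card_image inj_on_subset[OF inj_edges])
  qed
  then have "degree K ` verts K = degree H ` verts H"
    unfolding img[symmetric] by (auto simp: image_image)
  then show ?thesis by (simp add: max_degree_def)
qed

lemma is_copy_transversal_number_le:
  assumes H: "r_graph r H" and "is_copy H K" and T: "transversal K T"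
  shows "transversal_number H \<le> card T"
proof -
  obtain f where f: "bij_betw f (verts H) (verts K)" "edges K = (\<lambda>e. f ` e) ` edges H"
    using assms(2) by (auto simp: is_copy_def)
  let ?T = "{v \<in> verts H. f v \<in> T}"
  have sub: "e \<subseteq> verts H" if "e \<in> edges H" for e
    using that H by (auto simp: r_graph_def nsets_def)
  have "transversal H ?T"
    unfolding transversal_def
  proof (intro conjI ballI)
    fix e assume e: "e \<in> edges H"
    then have "f ` e \<inter> T \<noteq> {}"
      using T f(2) by (auto simp: transversal_def)
    with sub[OF e] show "e \<inter> ?T \<noteq> {}" by blast
  qed simp
  then have "transversal_number H \<le> card ?T"
    by (rule transversal_number_le)
  also have "card ?T = card T"
  proof (rule bij_betw_same_card)
    have "T \<subseteq> f ` verts H"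
      using T f(1) by (auto simp: transversal_def bij_betw_def)
    then show "bij_betw f ?T T"
      using f(1) by (auto simp: bij_betw_def intro: inj_on_subset)
  qed
  finally show ?thesis .
qed

section \<open>The extremal hypergraphs\<close>

lemma int_U_p:
  assumes "r \<ge> 2" "n \<ge> 1"
  shows "int (U_p n r k) = \<lceil>(real n - 1) / (real k * (real r - 1))\<rceil>"
proof -
  have "0 \<le> (real n - 1) / (real k * (real r - 1))"
    using assms by simp
  then have "0 \<le> \<lceil>(real n - 1) / (real k * (real r - 1))\<rceil>"
    by (metis ceiling_mono ceiling_zero)
  then show ?thesis
    by (simp add: U_p_def)
qed

lemma U_p_pos:
  assumes "r \<ge> 2" "k \<ge> 1" "n \<ge> 2"
  shows "U_p n r k \<ge> 1"
proof -
  have "0 < (real n - 1) / (real k * (real r - 1))"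
    using assms by simp
  then have "0 < \<lceil>(real n - 1) / (real k * (real r - 1))\<rceil>"
    by (simp only: zero_less_ceiling)
  then show ?thesis
    unfolding U_p_def by linarith
qed

lemma U_p_le:
  assumes "r \<ge> 2" "k \<ge> 1" "n \<ge> 1"
  shows "U_p n r k \<le> n"
proof -
  have "1 * 1 \<le> real k * (real r - 1)"
    using assms by (intro mult_mono) auto
  then have "(real n - 1) / (real k * (real r - 1)) \<le> (real n - 1) / 1"
    using assms by (intro divide_left_mono) auto
  then have "\<lceil>(real n - 1) / (real k * (real r - 1))\<rceil> \<le> int n"
    by (simp add: ceiling_le_iff)
  then show ?thesis
    unfolding U_p_def by linarith
qed

text \<open>The hubs \<open>y\<^sub>1, \<dots>, y\<^sub>p\<close> are the last \<open>p\<close> vertices.\<close>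

lemma U_M_hubs_transversal:
  assumes "r \<ge> 2" "k \<ge> 1" "n \<ge> 2"
  shows "transversal ({1..n}, U_M n r k) {n - U_p n r k + 1..n}"
proof -
  have p: "1 \<le> U_p n r k" "U_p n r k \<le> n"
    using U_p_pos U_p_le assms by auto
  have "\<exists>i\<in>{1..U_p n r k}. n - U_p n r k + i \<in> e" if "e \<in> U_M n r k" for e
    using that p unfolding U_M_def Let_def by fastforce
  then have "e \<inter> {n - U_p n r k + 1..n} \<noteq> {}" if "e \<in> U_M n r k" for e
    using that p(2) by fastforce
  then show ?thesis
    by (auto simp: transversal_def)
qed

lemma is_copy_U_graph_transversal_number_le:
  assumes r: "r \<ge> 2" and S: "valid_choice S"
    and H: "r_graph r H" "connected_hypergraph H" "card (verts H) \<ge> 2"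
    and copy: "is_copy H (U_graph S (card (verts H)) r (max_degree H))"
  shows "transversal_number H \<le> U_p (card (verts H)) r (max_degree H)"
proof -
  define n where "n = card (verts H)"
  define k where "k = max_degree H"
  have n: "n \<ge> 2" and k: "k \<ge> 1"
    using H max_degree_pos[OF _ H] r by (auto simp: n_def k_def)
  have copy': "is_copy H (U_graph S n r k)"
    using copy by (simp add: n_def k_def)
  obtain T where T: "transversal (U_graph S n r k) T" "card T \<le> U_p n r k"
  proof -
    consider "k = 1" | "k \<ge> 2" "n > k * (r - 1) + 1" | "k \<ge> 2" "n \<le> k * (r - 1) + 1"
      using k by linarith
    then show thesis
    proof cases
      case 1
      have "transversal (U_graph S n r k) {1}"
        using 1 r by (simp add: U_graph_def transversal_def)
      with that U_p_pos[OF r k n] show thesis by simp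
    next
      case 2
      then have "U_graph S n r k = ({1..n}, U_M n r k)"
        by (simp add: U_graph_def)
      with that[of "{n - U_p n r k + 1..n}"] U_M_hubs_transversal[OF r k n] U_p_le[OF r k] n
      show thesis by simp
    next
      case 3
      then have U: "U_graph S n r k = ({1..n}, S n r k)"
        by (simp add: U_graph_def)
      \<comment> \<open>The copy itself witnesses that \<open>n\<close> is in the range where \<open>S\<close> is constrained.\<close>
      have "min_order r k \<le> n"
        unfolding min_order_def
      proof (rule Least_le, intro exI conjI)
        show "r_graph r (U_graph S n r k)"
          using H(1) copy' by (rule is_copy_r_graph)
        show "max_degree (U_graph S n r k) = k"
          using is_copy_max_degree[OF H(1) copy'] by (simp add: k_def)
        show "card (verts (U_graph S n r k)) = n"
          by (simp add: U)
      qed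
      with 3 S r have "S n r k \<subseteq> {A \<in> nsets {1..n} r. n \<in> A}"
        unfolding valid_choice_def by blast
      then have "transversal (U_graph S n r k) {n}"
        using n by (auto simp: U transversal_def)
      with that U_p_pos[OF r k n] show thesis by simp
    qed
  qed
  have "transversal_number H \<le> card T"
    using is_copy_transversal_number_le[OF H(1) copy' T(1)] .
  with T(2) show ?thesis by (simp add: n_def k_def)
qed

theorem corollary2p4:
  fixes r :: nat and G :: "'a hypergraph"
  assumes "r \<ge> 2" and "r_graph r G"
  shows "int (transversal_number G) \<ge>
           (\<Sum>H\<in>nonsingleton_components r G.
              \<lceil>(real (card (verts H)) - 1) / (real (max_degree H) * (real r - 1))\<rceil>) \<and>
         (\<forall>S. valid_choice S \<longrightarrow>
            (\<forall>H\<in>nonsingleton_components r G.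
               is_copy H (U_graph S (card (verts H)) r (max_degree H))) \<longrightarrow>
            int (transversal_number G) =
              (\<Sum>H\<in>nonsingleton_components r G.
                 \<lceil>(real (card (verts H)) - 1) / (real (max_degree H) * (real r - 1))\<rceil>))"
proof -
  let ?C = "nonsingleton_components r G"
  let ?b = "\<lambda>H :: 'a hypergraph.
    \<lceil>(real (card (verts H)) - 1) / (real (max_degree H) * (real r - 1))\<rceil>"
  note comp = nonsingleton_component_connected[of _ r G]
  have sum: "int (transversal_number G) = (\<Sum>H\<in>?C. int (transversal_number H))"
    using transversal_number_sum_components[OF assms] by simp
  have lower: "?b H \<le> int (transversal_number H)" if "H \<in> ?C" for H
    using connected_transversal_number_ge[OF assms(1) comp(1,2)] that by blast
  have upper: "int (transversal_number H) \<le> ?b H"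
    if "valid_choice S" "H \<in> ?C" "is_copy H (U_graph S (card (verts H)) r (max_degree H))" for S H
  proof -
    note H = comp(1-3)[OF that(2)]
    have "transversal_number H \<le> U_p (card (verts H)) r (max_degree H)"
      using is_copy_U_graph_transversal_number_le[OF assms(1) that(1) H that(3)] .
    then show ?thesis
      using int_U_p[of r "card (verts H)" "max_degree H"] assms(1) H(3) by linarith
  qed
  show ?thesis
    unfolding sum
  proof (intro conjI allI impI)
    show "(\<Sum>H\<in>?C. ?b H) \<le> (\<Sum>H\<in>?C. int (transversal_number H))"
      using lower by (rule sum_mono)
  next
    fix S
    assume "valid_choice S" "\<forall>H\<in>?C. is_copy H (U_graph S (card (verts H)) r (max_degree H))"
    then show "(\<Sum>H\<in>?C. int (transversal_number H)) = (\<Sum>H\<in>?C. ?b H)"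
      using lower upper by (intro sum.cong antisym) auto
  qed
qed

end
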